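(* Let $X$ be a regular (Hausdorff) topological space which is $L$-tight and whose dispersion character satisfies $\Delta(X)>\omega$. Then $X$ is $\omega$-resolvable.
   Context: All spaces are Hausdorff, and regular spaces are in particular Hausdorff. A subspace is Lindelöf if every cover of it by open sets has a countable subcover. A space $X$ is $L$-tight if for all $x\in X$ and $A\subseteq X$ with $x\in\overline{A}$ there exists a Lindelöf subspace $B\subseteq A$ with $x\in\overline{B}$. The dispersion character $\Delta(X)$ is the smallest cardinality of a non-empty open subset of $X$. A space is $\tau$-resolvable if it can be represented as a union of $\tau$ pairwise disjoint dense subsets. $\omega$ is the smallest infinite cardinal. *)

theory Defs
  imports "HOL-Analysis.Analysis"
begin

unbundle cardinal_syntax

definition L_tight :: "'a topology \<Rightarrow> bool" where
  "L_tight X \<longleftrightarrow>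
     (\<forall>A x. A \<subseteq> topspace X \<and> x \<in> X closure_of A \<longrightarrow>
        (\<exists>B\<subseteq>A. Lindelof_space (subtopology X B) \<and> x \<in> X closure_of B))"

(* The cardinal of a non-empty open set of least cardinality.  The choice of that set does
   not matter up to =o.  The value is unspecified if the space is empty. *)
definition dispersion_character :: "'a topology \<Rightarrow> 'a rel" where
  "dispersion_character X =
     |SOME U. openin X U \<and> U \<noteq> {} \<and> (\<forall>V. openin X V \<and> V \<noteq> {} \<longrightarrow> |U| \<le>o |V| )|"

lemma dispersion_character_attained:
  assumes "topspace X \<noteq> {}"
  shows "\<exists>U. openin X U \<and> U \<noteq> {} \<and> dispersion_character X = |U|
            \<and> (\<forall>V. openin X V \<and> V \<noteq> {} \<longrightarrow> |U| \<le>o |V| )"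
proof -
  let ?R = "card_of ` {U. openin X U \<and> U \<noteq> {}}"
  have "topspace X \<in> {U. openin X U \<and> U \<noteq> {}}"
    using assms by simp
  then have "?R \<noteq> {}"
    by (metis empty_iff image_is_empty)
  moreover have "\<forall>r\<in>?R. Card_order r"
    by (simp add: card_of_Card_order)
  ultimately have "\<exists>r\<in>?R. \<forall>r'\<in>?R. r \<le>o r'"
    by (rule exists_minim_Card_order)
  then obtain r where r: "r \<in> ?R" "\<forall>r'\<in>?R. r \<le>o r'"
    by (rule bexE)
  from r(1) obtain U where U: "r = |U|" "openin X U" "U \<noteq> {}"
    by (elim imageE) simp
  have "\<forall>V. openin X V \<and> V \<noteq> {} \<longrightarrow> |U| \<le>o |V|"
    using r(2) U(1) by simp
  with U have "\<exists>U. openin X U \<and> U \<noteq> {} \<and> (\<forall>V. openin X V \<and> V \<noteq> {} \<longrightarrow> |U| \<le>o |V| )"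
    by (intro exI[of _ U]) simp
  note * = someI_ex[OF this]
  show ?thesis
    unfolding dispersion_character_def
    by (rule exI, intro conjI, rule conjunct1[OF *], rule conjunct1[OF conjunct2[OF *]],
        rule refl, rule conjunct2[OF conjunct2[OF *]])
qed

(* The cardinal r is given as a relation, and the family is indexed by the underlying set of r. *)
definition resolvable :: "'b rel \<Rightarrow> 'a topology \<Rightarrow> bool" where
  "resolvable r X \<longleftrightarrow>
     (\<exists>D. (\<forall>i\<in>Field r. X closure_of D i = topspace X)
        \<and> disjoint_family_on D (Field r)
        \<and> (\<Union>i\<in>Field r. D i) = topspace X)"

end

theory Submission
  imports Defs
begin

text \<open>
  A union of pairwise disjoint $\omega$-resolvable subspaces is $\omega$-resolvable, and so is every
  subspace between an $\omega$-resolvable one and its closure. By Zorn's lemma it is therefore enough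
  to find a non-empty $\omega$-resolvable subspace inside every non-empty open set $G$. Let $G$ contain
  none. Call a subset $Z$ of $G$ \<^emph>\<open>thick\<close> if its non-empty relatively open subsets are uncountable, and
  let $T(Z)$ be the set of points of $Z$ that are limits of a discrete subset of $Z$. For thick $Z$,
  two facts hold.

  \<^item> $Z - T(Z)$ is dense in $Z$. Otherwise a non-empty relatively open set $S$ consists of limits of discrete
    subsets of $S$; by $L$-tightness these may be taken Lindelof, that is, countable. In a regular
    space countable discrete sets expand to disjoint open sets, which allows one to build disjoint
    countable discrete sets $E_0, E_1, \ldots$ in $S$ with $E_n \subseteq \overline{E_{n+1}}$, and the
    union of such a sequence is $\omega$-resolvable.

  \<^item> $T(Z)$ is thick and dense in $Z$. Otherwise some non-empty thick set $Y \subseteq Z$ has no points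
    that are limits of discrete subsets of $Y$. Every Lindelof subset of $Y$ is then hereditarily Lindelof, and
    an uncountable hereditarily Lindelof space contains an $\omega$-resolvable subspace; so the
    Lindelof subsets of $Y$ are countable, and $L$-tightness turns into countable tightness. As the
    complement of a countable subset is dense in $Y$, one again gets disjoint countable sets
    with $E_n \subseteq \overline{E_{n+1}}$.

  Hence $G \supseteq T(G) \supseteq T(T(G)) \supseteq \cdots$ are all thick and dense in $G$, and the
  successive differences are infinitely many disjoint dense subsets of $G$, a contradiction.

  The remaining ingredient, on uncountable hereditarily Lindelof spaces, is about transfinite ranks. The
  points of a set are given integer colours and countable ordinals as ranks so that each point $y$ is,
  for every $j$ below its rank, a limit of points of rank at least $j$ whose colour is one higher. If
  the ranks are unbounded in $\omega_1$, then by the Lindelof property the closures of the sets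
  $P_j$ of points of rank at least $j$ stabilise, and from then on every neighbourhood of a point of
  $P_j$ contains points of $P_j$ of all sufficiently large colours: $P_j$ is $\omega$-resolvable. Unbounded
  ranks are obtained by gluing, over $\omega_1$ disjoint pieces, rankings that reach every countable
  ordinal. Those exist by induction; the limit steps need a point at which some function to the natural
  numbers is unbounded on every neighbourhood, which an Ulam-type argument provides.
\<close>

section \<open>Resolvable subspaces\<close>

text \<open>
  The disjoint dense sets are the fibres of a colouring, which makes them disjoint by construction and
  lets them cover $P$. All closures are taken in the ambient space: this replaces the density of a
  fibre in the subspace $P$.
\<close>
definition \<omega>_resolvable_in :: "'a topology \<Rightarrow> 'a set \<Rightarrow> bool" where
  "\<omega>_resolvable_in X P \<longleftrightarrow> P \<subseteq> topspace X \<and>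
     (\<exists>f :: 'a \<Rightarrow> nat. \<forall>k. P \<subseteq> X closure_of {x \<in> P. f x = k})"

lemma closure_ofD: "x \<in> X closure_of S \<Longrightarrow> openin X T \<Longrightarrow> x \<in> T \<Longrightarrow> \<exists>y\<in>S. y \<in> T"
  by (auto simp: in_closure_of)

lemma closure_ofI: "x \<in> topspace X \<Longrightarrow> (\<And>T. openin X T \<Longrightarrow> x \<in> T \<Longrightarrow> \<exists>y\<in>S. y \<in> T) \<Longrightarrow> x \<in> X closure_of S"
  by (auto simp: in_closure_of)

lemma resolvable_natLeq_if_\<omega>_resolvable_in:
  assumes "\<omega>_resolvable_in X (topspace X)"
  shows "resolvable natLeq X"
proof -
  from assms obtain f :: "'a \<Rightarrow> nat"
    where f: "\<And>k. topspace X \<subseteq> X closure_of {x \<in> topspace X. f x = k}"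
    by (auto simp: \<omega>_resolvable_in_def)
  show ?thesis
    unfolding resolvable_def
  proof (intro exI[of _ "\<lambda>k. {x \<in> topspace X. f x = k}"] conjI)
    show "\<forall>i\<in>Field natLeq. X closure_of {x \<in> topspace X. f x = i} = topspace X"
      by (intro ballI subset_antisym closure_of_subset_topspace f)
    show "disjoint_family_on (\<lambda>k. {x \<in> topspace X. f x = k}) (Field natLeq)"
      by (auto simp: disjoint_family_on_def)
    show "(\<Union>i\<in>Field natLeq. {x \<in> topspace X. f x = i}) = topspace X"
      by (auto simp: Field_natLeq)
  qed
qed

lemma \<omega>_resolvable_in_closure:
  assumes "\<omega>_resolvable_in X P" and "P \<subseteq> Q" and "Q \<subseteq> X closure_of P"
  shows "\<omega>_resolvable_in X Q"
proof -
  from assms obtain f :: "'a \<Rightarrow> nat"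
    where f: "\<And>k. P \<subseteq> X closure_of {x \<in> P. f x = k}"
    by (auto simp: \<omega>_resolvable_in_def)
  have "Q \<subseteq> X closure_of {x \<in> Q. f x = k}" for k
  proof -
    have "X closure_of P \<subseteq> X closure_of {x \<in> P. f x = k}"
      using closure_of_mono[OF f[of k], of X] by simp
    moreover
    have "{x \<in> P. f x = k} \<subseteq> {x \<in> Q. f x = k}"
      using assms(2) by auto
    then have "X closure_of {x \<in> P. f x = k} \<subseteq> X closure_of {x \<in> Q. f x = k}"
      by (rule closure_of_mono)
    ultimately show ?thesis
      using assms(3) by (metis subset_trans)
  qed
  moreover have "Q \<subseteq> topspace X"
    using assms(3) closure_of_subset_topspace by (rule subset_trans)
  ultimately show ?thesis
    by (auto simp: \<omega>_resolvable_in_def)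
qed

lemma \<omega>_resolvable_in_disjoint_Union:
  assumes "disjoint F" and res: "\<And>P. P \<in> F \<Longrightarrow> \<omega>_resolvable_in X P"
  shows "\<omega>_resolvable_in X (\<Union>F)"
proof -
  have "\<forall>P. \<exists>f :: 'a \<Rightarrow> nat. P \<in> F \<longrightarrow> (\<forall>k. P \<subseteq> X closure_of {x \<in> P. f x = k})"
    using res by (auto simp: \<omega>_resolvable_in_def)
  then obtain f :: "'a set \<Rightarrow> 'a \<Rightarrow> nat"
    where f: "\<And>P k. P \<in> F \<Longrightarrow> P \<subseteq> X closure_of {x \<in> P. f P x = k}"
    by metis
  define g where "g x = f (THE P. P \<in> F \<and> x \<in> P) x" for x
  have g: "g x = f P x" if "P \<in> F" "x \<in> P" for P x
  proof -
    have "(THE Q. Q \<in> F \<and> x \<in> Q) = P"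
      using that assms(1) by (intro the_equality) (auto simp: disjoint_def)
    then show ?thesis by (simp add: g_def)
  qed
  have "\<Union>F \<subseteq> X closure_of {x \<in> \<Union>F. g x = k}" for k
  proof
    fix x assume "x \<in> \<Union>F"
    then obtain P where P: "P \<in> F" "x \<in> P" by blast
    then have "x \<in> X closure_of {x \<in> P. f P x = k}"
      using f by blast
    moreover have "{x \<in> P. f P x = k} \<subseteq> {x \<in> \<Union>F. g x = k}"
      using P g by auto
    ultimately show "x \<in> X closure_of {x \<in> \<Union>F. g x = k}"
      using closure_of_mono by blast
  qed
  moreover have "\<Union>F \<subseteq> topspace X"
    using res by (auto simp: \<omega>_resolvable_in_def)
  ultimately show ?thesis
    by (auto simp: \<omega>_resolvable_in_def)
qed

text \<open>
  A maximal disjoint family of non-empty $\omega$-resolvable subspaces has a dense union, because a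
  further member could be found in the complement of the closure.
\<close>
lemma \<omega>_resolvable_in_topspace_if_locally:
  assumes loc: "\<And>G. openin X G \<Longrightarrow> G \<noteq> {} \<Longrightarrow> \<exists>P\<subseteq>G. P \<noteq> {} \<and> \<omega>_resolvable_in X P"
  shows "\<omega>_resolvable_in X (topspace X)"
proof -
  let ?A = "{F. disjoint F \<and> (\<forall>P\<in>F. P \<noteq> {} \<and> \<omega>_resolvable_in X P)}"
  have "\<exists>F\<in>?A. \<forall>F'\<in>?A. F \<subseteq> F' \<longrightarrow> F' = F"
  proof (rule subset_Zorn')
    fix \<C> assume ch: "subset.chain ?A \<C>"
    have "disjoint (\<Union>\<C>)"
      unfolding disjoint_def
    proof (intro ballI impI)
      fix P Q assume "P \<in> \<Union>\<C>" "Q \<in> \<Union>\<C>" "P \<noteq> Q"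
      then obtain F1 F2 where F: "F1 \<in> \<C>" "F2 \<in> \<C>" "P \<in> F1" "Q \<in> F2" by blast
      then have "F1 \<subseteq> F2 \<or> F2 \<subseteq> F1" "disjoint F1" "disjoint F2"
        using ch unfolding subset.chain_def by (blast+)
      then show "P \<inter> Q = {}"
        using F \<open>P \<noteq> Q\<close> unfolding disjoint_def by blast
    qed
    moreover have "\<forall>P\<in>\<Union>\<C>. P \<noteq> {} \<and> \<omega>_resolvable_in X P"
      using ch unfolding subset.chain_def by blast
    ultimately show "\<Union>\<C> \<in> ?A" by blast
  qed
  then obtain F where "F \<in> ?A" and max: "\<forall>F'\<in>?A. F \<subseteq> F' \<longrightarrow> F' = F"
    by (rule bexE)
  then have F: "disjoint F" "\<And>P. P \<in> F \<Longrightarrow> P \<noteq> {} \<and> \<omega>_resolvable_in X P"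
    by (simp_all add: mem_Collect_eq)
  have res: "\<omega>_resolvable_in X (\<Union>F)"
    using F by (intro \<omega>_resolvable_in_disjoint_Union) auto
  then have sub: "\<Union>F \<subseteq> X closure_of \<Union>F"
    by (intro closure_of_subset) (simp add: \<omega>_resolvable_in_def)
  have "topspace X \<subseteq> X closure_of \<Union>F"
  proof (rule ccontr)
    assume "\<not> ?thesis"
    then have "topspace X - X closure_of \<Union>F \<noteq> {}"
      by blast
    moreover have "openin X (topspace X - X closure_of \<Union>F)"
      by (simp add: openin_diff)
    ultimately obtain P where P: "P \<subseteq> topspace X - X closure_of \<Union>F" "P \<noteq> {}" "\<omega>_resolvable_in X P"
      using loc by meson
    then have dis: "P \<inter> \<Union>F = {}"
      using sub by blast
    then have "disjoint (insert P F)"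
      using F(1) unfolding disjoint_def by blast
    then have "insert P F \<in> ?A"
      using F(2) P(2,3) by simp
    then have "insert P F = F"
      using max by (meson subset_insertI)
    then have "P \<in> F"
      by blast
    then show False
      using dis P(2) by blast
  qed
  then show ?thesis
    using res \<omega>_resolvable_in_closure by (metis \<omega>_resolvable_in_def)
qed

text \<open>
  The colours themselves may fail to be dense. Splitting the natural numbers into infinitely many infinite
  sets and merging the colours in each of them gives dense fibres.
\<close>
lemma \<omega>_resolvable_in_if_eventually_all_colours:
  fixes c :: "'a \<Rightarrow> nat"
  assumes "P \<subseteq> topspace X"
    and ev: "\<And>U. openin X U \<Longrightarrow> U \<inter> P \<noteq> {} \<Longrightarrow> \<exists>N. \<forall>n\<ge>N. \<exists>z\<in>U \<inter> P. c z = n"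
  shows "\<omega>_resolvable_in X P"
proof -
  have "P \<subseteq> X closure_of {x \<in> P. fst (prod_decode (c x)) = k}" for k
  proof (rule subsetI, rule closure_ofI)
    fix x U assume "x \<in> P" and U: "openin X U" "x \<in> U"
    then obtain N where N: "\<And>n. n \<ge> N \<Longrightarrow> \<exists>z\<in>U \<inter> P. c z = n"
      using ev[of U] by blast
    from N[OF le_prod_encode_2[of N k]] obtain z where "z \<in> U \<inter> P" "c z = prod_encode (k, N)"
      by blast
    then show "\<exists>y\<in>{x \<in> P. fst (prod_decode (c x)) = k}. y \<in> U"
      by (intro bexI[of _ z]) auto
  qed (use assms(1) in blast)
  then show ?thesis
    unfolding \<omega>_resolvable_in_def using assms(1)
    by (intro conjI exI[of _ "\<lambda>x. fst (prod_decode (c x))"] allI)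
qed

text \<open>
  An open set that meets $E_N$ meets $E_n$ for all $n \geq N$.
\<close>
lemma \<omega>_resolvable_in_UN_sequence:
  fixes E :: "nat \<Rightarrow> 'a set"
  assumes sub: "\<And>n. E n \<subseteq> topspace X"
    and dis: "\<And>m n. m < n \<Longrightarrow> E m \<inter> E n = {}"
    and cl: "\<And>n. E n \<subseteq> X closure_of E (Suc n)"
  shows "\<omega>_resolvable_in X (\<Union>n. E n)"
proof -
  define c where "c x = (LEAST n. x \<in> E n)" for x
  have c: "c x = n" if "x \<in> E n" for x n
  proof -
    have "x \<in> E (c x)"
      unfolding c_def using that by (rule LeastI)
    then show ?thesis
      using that dis[of n "c x"] dis[of "c x" n] by (cases n "c x" rule: linorder_cases) auto
  qed
  show ?thesis
  proof (rule \<omega>_resolvable_in_if_eventually_all_colours[where c = c])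
    show "(\<Union>n. E n) \<subseteq> topspace X" using sub by blast
    fix U assume U: "openin X U" "U \<inter> (\<Union>n. E n) \<noteq> {}"
    then obtain N where N: "U \<inter> E N \<noteq> {}" by blast
    have "U \<inter> E n \<noteq> {}" if "n \<ge> N" for n
      using that
    proof (induction rule: dec_induct)
      case (step n)
      then obtain x where "x \<in> U" "x \<in> E n" by blast
      then have "x \<in> X closure_of E (Suc n)"
        using cl by blast
      from closure_ofD[OF this U(1) \<open>x \<in> U\<close>] show ?case by blast
    qed (rule N)
    then have "\<forall>n\<ge>N. \<exists>z\<in>U \<inter> (\<Union>n. E n). c z = n"
    proof (intro allI impI)
      fix n assume "N \<le> n"
      then obtain z where z: "z \<in> U" "z \<in> E n"
        using \<open>\<And>n. N \<le> n \<Longrightarrow> U \<inter> E n \<noteq> {}\<close>[of n] by auto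
      then show "\<exists>z\<in>U \<inter> (\<Union>n. E n). c z = n"
        using c[of z n] by (intro bexI[of _ z]) auto
    qed
    then show "\<exists>N. \<forall>n\<ge>N. \<exists>z\<in>U \<inter> (\<Union>n. E n). c z = n" ..
  qed
qed


section \<open>The first uncountable ordinal\<close>

text \<open>
  As a type in class \<^class>\<open>wellorder\<close>, the ordinal $\omega_1$ is available both for indexing families
  and for ranks; all that matters is that it is uncountable while its proper initial segments are
  countable.
\<close>
typedef omega_one = "Field (cardSuc natLeq)"
  by (metis Field_cardSuc_not_empty natLeq_Card_order ex_in_conv)

instantiation omega_one :: wellorder
begin

definition less_eq_omega_one :: "omega_one \<Rightarrow> omega_one \<Rightarrow> bool" where
  "i \<le> j \<longleftrightarrow> (Rep_omega_one i, Rep_omega_one j) \<in> cardSuc natLeq"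

definition less_omega_one :: "omega_one \<Rightarrow> omega_one \<Rightarrow> bool" where
  "less_omega_one i j \<longleftrightarrow> i \<le> j \<and> i \<noteq> j"

instance
proof
  have W: "Well_order (cardSuc natLeq)"
    by (simp add: cardSuc_Well_order natLeq_Card_order)
  then have refl: "refl_on (Field (cardSuc natLeq)) (cardSuc natLeq)"
    and trans: "trans (cardSuc natLeq)" and antisym: "antisym (cardSuc natLeq)"
    and total: "total_on (Field (cardSuc natLeq)) (cardSuc natLeq)"
    and wf: "wf (cardSuc natLeq - Id)"
    by (auto simp: well_order_on_def linear_order_on_def partial_order_on_def preorder_on_def)
  fix i j k :: omega_one
  show anti: "i = j" if "i \<le> j" "j \<le> i" for i j :: omega_one
    using that antisym unfolding less_eq_omega_one_def
    by (metis Rep_omega_one_inject antisymD)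
  show "i < j \<longleftrightarrow> i \<le> j \<and> \<not> j \<le> i"
    using anti by (auto simp: less_omega_one_def)
  show "i \<le> i"
    using refl Rep_omega_one by (auto simp: less_eq_omega_one_def refl_on_def)
  show "i \<le> k" if "i \<le> j" "j \<le> k"
    using that trans unfolding less_eq_omega_one_def by (meson transD)
  show tot: "i \<le> j \<or> j \<le> i"
    using total Rep_omega_one \<open>i \<le> i\<close> unfolding less_eq_omega_one_def total_on_def
    by (metis Rep_omega_one_inject)
  fix P and a :: omega_one
  assume P: "\<And>x :: omega_one. (\<And>y. y < x \<Longrightarrow> P y) \<Longrightarrow> P x"
  have "{(i, j :: omega_one). i < j} = inv_image (cardSuc natLeq - Id) Rep_omega_one"
    by (auto simp: less_omega_one_def less_eq_omega_one_def inv_image_def Rep_omega_one_inject)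
  then have "wf {(i, j :: omega_one). i < j}"
    using wf by simp
  then show "P a"
    by (induction a rule: wf_induct_rule) (simp add: P)
qed

end

lemma card_of_omega_one: "|UNIV :: omega_one set| =o cardSuc natLeq"
proof -
  have "bij_betw Rep_omega_one UNIV (Field (cardSuc natLeq))"
    by (metis Rep_omega_one_inject bij_betw_def inj_onI type_definition.Rep_range type_definition_omega_one)
  then have "|UNIV :: omega_one set| =o |Field (cardSuc natLeq)|"
    using card_of_ordIso by blast
  then show ?thesis
    using card_of_Field_ordIso cardSuc_Card_order natLeq_Card_order ordIso_transitive by blast
qed

lemma countable_iff_ordLeq: "countable A \<longleftrightarrow> |A| \<le>o natLeq"
  by (metis card_of_nat card_of_ordLeq countable_def inj_on_def ordLeq_ordIso_trans ordIso_symmetric subset_UNIV)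

lemma uncountable_omega_one: "uncountable (UNIV :: omega_one set)"
proof
  assume "countable (UNIV :: omega_one set)"
  then have "cardSuc natLeq \<le>o natLeq"
    using card_of_omega_one countable_iff_ordLeq ordIso_ordLeq_trans ordIso_symmetric by blast
  then show False
    using cardSuc_greater natLeq_Card_order not_ordLess_ordLeq by blast
qed

lemma countable_lessThan_omega_one: "countable {..<i :: omega_one}"
proof -
  have "|underS (cardSuc natLeq) (Rep_omega_one i)| <o cardSuc natLeq"
    by (rule card_of_underS) (auto simp: cardSuc_Card_order natLeq_Card_order Rep_omega_one)
  then have "countable (underS (cardSuc natLeq) (Rep_omega_one i))"
    by (simp add: countable_iff_ordLeq cardSuc_ordLess_ordLeq natLeq_Card_order cardSuc_ordLeq_ordLess
        card_of_Card_order)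
  moreover have "Rep_omega_one ` {..<i} \<subseteq> underS (cardSuc natLeq) (Rep_omega_one i)"
    by (auto simp: underS_def less_omega_one_def less_eq_omega_one_def Rep_omega_one_inject)
  ultimately show ?thesis
    by (meson Rep_omega_one_inject countable_image_inj_on countable_subset inj_onI)
qed

lemma omega_one_countable_bounded:
  assumes "countable C" shows "\<exists>j :: omega_one. \<forall>i\<in>C. i < j"
proof -
  have "{..i} = insert i {..<i}" for i :: omega_one by auto
  then have "countable (\<Union>i\<in>C. {..i})"
    using assms countable_lessThan_omega_one by auto
  then have "(\<Union>i\<in>C. {..i}) \<noteq> UNIV"
    using uncountable_omega_one by metis
  then obtain j where "j \<notin> (\<Union>i\<in>C. {..i})" by blast
  then show ?thesis
    by (auto intro!: exI[of _ j] simp: not_le)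
qed

lemma omega_one_embeds:
  assumes "uncountable Y"
  obtains g :: "omega_one \<Rightarrow> 'a" where "inj g" "range g \<subseteq> Y"
proof -
  have "cardSuc natLeq \<le>o |Y|"
    using assms cardSuc_least natLeq_Card_order
    by (metis card_of_Card_order card_of_Well_order countable_iff_ordLeq natLeq_Well_order not_ordLeq_iff_ordLess)
  then have "|UNIV :: omega_one set| \<le>o |Y|"
    using card_of_omega_one ordIso_ordLeq_trans by blast
  then show ?thesis
    using that card_of_ordLeq[of "UNIV :: omega_one set" Y] by blast
qed

lemma omega_one_pairs_embed:
  assumes "uncountable Y"
  obtains g :: "omega_one \<times> omega_one \<Rightarrow> 'a" where "inj g" "range g \<subseteq> Y"
proof -
  obtain h :: "omega_one \<Rightarrow> 'a" where h: "inj h" "range h \<subseteq> Y"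
    using omega_one_embeds[OF assms] .
  have "infinite (UNIV :: omega_one set)"
    using uncountable_omega_one countable_finite by blast
  then have "|UNIV \<times> UNIV :: (omega_one \<times> omega_one) set| =o |UNIV :: omega_one set|"
    by (rule card_of_Times_same_infinite)
  then obtain k :: "omega_one \<times> omega_one \<Rightarrow> omega_one" where "inj k"
    using card_of_ordIso[of "UNIV \<times> UNIV :: (omega_one \<times> omega_one) set" "UNIV :: omega_one set"]
    by (auto simp: bij_betw_def)
  with h show ?thesis
    by (intro that[of "h \<circ> k"]) (auto intro: inj_compose)
qed


section \<open>Hereditarily Lindelof subspaces\<close>

text \<open>
  The covers are not required to cover $A$: this says at once that every subspace of $A$ is Lindelof.
\<close>
definition hereditarily_Lindelof_in :: "'a topology \<Rightarrow> 'a set \<Rightarrow> bool" where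
  "hereditarily_Lindelof_in X A \<longleftrightarrow> A \<subseteq> topspace X \<and>
     (\<forall>\<U>. (\<forall>U\<in>\<U>. openin X U) \<longrightarrow> (\<exists>\<V>\<subseteq>\<U>. countable \<V> \<and> A \<inter> \<Union>\<U> \<subseteq> \<Union>\<V>))"

lemma hereditarily_Lindelof_in_subset:
  assumes "hereditarily_Lindelof_in X A" and "B \<subseteq> A"
  shows "hereditarily_Lindelof_in X B"
  unfolding hereditarily_Lindelof_in_def
proof (intro conjI allI impI)
  show "B \<subseteq> topspace X"
    using assms by (auto simp: hereditarily_Lindelof_in_def)
  fix \<U> assume "\<forall>U\<in>\<U>. openin X U"
  then obtain \<V> where "\<V> \<subseteq> \<U>" "countable \<V>" "A \<inter> \<Union>\<U> \<subseteq> \<Union>\<V>"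
    using assms(1) unfolding hereditarily_Lindelof_in_def by meson
  then show "\<exists>\<V>\<subseteq>\<U>. countable \<V> \<and> B \<inter> \<Union>\<U> \<subseteq> \<Union>\<V>"
    using assms(2) by (intro exI[of _ \<V>]) auto
qed

lemma hereditarily_Lindelof_in_indexed:
  assumes "hereditarily_Lindelof_in X A" and "\<And>i. i \<in> I \<Longrightarrow> openin X (U i)"
  obtains J where "J \<subseteq> I" "countable J" "A \<inter> (\<Union>i\<in>I. U i) \<subseteq> (\<Union>i\<in>J. U i)"
proof -
  have "\<forall>V\<in>U ` I. openin X V"
    using assms(2) by auto
  then obtain \<V> where "\<V> \<subseteq> U ` I" "countable \<V>" "A \<inter> \<Union>(U ` I) \<subseteq> \<Union>\<V>"
    using assms(1) unfolding hereditarily_Lindelof_in_def by meson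
  moreover from this obtain J where "J \<subseteq> I" "countable J" "\<V> = U ` J"
    using countable_subset_image[of \<V> U I] by auto
  ultimately show ?thesis
    by (intro that[of J]) auto
qed

text \<open>
  Suppose that every function is locally bounded. Injections $e_i$ of the countable initial segments
  below $i$ into the natural numbers give, for each $b < \omega_1$, the function $i \mapsto e_i(b)$, bounded by
  $k(b)$ on a neighbourhood $V_b$ of $g(b)$. On an uncountable set $A$ of indices the bound $k$ is
  constant, so by injectivity each $g(i)$ lies in only finitely many $V_b$ with $b \in A$, $b < i$. But the
  Lindelof property, applied to the tails of $A$, places infinitely many disjoint countable
  blocks of indices below some $i \in A$, each of which contains a $b$ with $g(i) \in V_b$.
\<close>
lemma hereditarily_Lindelof_in_unbounded_function:
  fixes g :: "omega_one \<Rightarrow> 'a"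
  assumes HL: "hereditarily_Lindelof_in X (range g)"
  obtains b and m :: "omega_one \<Rightarrow> nat"
  where "\<And>V k. openin X V \<Longrightarrow> g b \<in> V \<Longrightarrow> \<exists>i. g i \<in> V \<and> k < m i"
proof -
  have "\<exists>b (m :: omega_one \<Rightarrow> nat). \<forall>V k. openin X V \<and> g b \<in> V \<longrightarrow> (\<exists>i. g i \<in> V \<and> k < m i)"
  proof (rule ccontr)
    assume neg: "\<not> ?thesis"
    have bd: "\<exists>V k. openin X V \<and> g b \<in> V \<and> (\<forall>i. g i \<in> V \<longrightarrow> m i \<le> k)"
      for b and m :: "omega_one \<Rightarrow> nat"
    proof (rule ccontr)
      assume "\<not> ?thesis"
      then have *: "\<forall>V k. openin X V \<and> g b \<in> V \<longrightarrow> (\<exists>i. g i \<in> V \<and> k < m i)"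
        by (auto simp: not_le)
      from neg show False
        by (rule notE) (rule exI, rule exI, rule *)
    qed
    define e :: "omega_one \<Rightarrow> omega_one \<Rightarrow> nat" where "e i = to_nat_on {..<i}" for i
    have e: "inj_on (e i) {..<i}" for i
      unfolding e_def by (rule inj_on_to_nat_on[OF countable_lessThan_omega_one])
    have "\<forall>b. \<exists>V k. openin X V \<and> g b \<in> V \<and> (\<forall>i. g i \<in> V \<longrightarrow> (if b < i then e i b else 0) \<le> k)"
      by (intro allI bd)
    then obtain V :: "omega_one \<Rightarrow> 'a set" and k :: "omega_one \<Rightarrow> nat"
      where V: "\<And>b. openin X (V b)" "\<And>b. g b \<in> V b"
        and k: "\<And>b i. g i \<in> V b \<Longrightarrow> (if b < i then e i b else 0) \<le> k b"
      by metis
    have "(\<Union>n. {b. k b = n}) = UNIV" by auto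
    then obtain n where n: "uncountable {b. k b = n}"
      using uncountable_omega_one by (metis countable_UN uncountable_def countableI_type)
    define A where "A = {b. k b = n}"
    have fin: "finite {b\<in>A. b < i \<and> g i \<in> V b}" for i
    proof (rule finite_imageD[of "e i"])
      have "e i ` {b\<in>A. b < i \<and> g i \<in> V b} \<subseteq> {..n}"
        using k unfolding A_def by fastforce
      then show "finite (e i ` {b\<in>A. b < i \<and> g i \<in> V b})"
        using finite_subset by blast
      show "inj_on (e i) {b\<in>A. b < i \<and> g i \<in> V b}"
        using e[of i] by (rule inj_on_subset) auto
    qed
    have "\<exists>d'. \<forall>i\<in>A. d' \<le> i \<longrightarrow> (\<exists>b\<in>A. d \<le> b \<and> b < d' \<and> g i \<in> V b)" for d
    proof -
      obtain J where J: "J \<subseteq> {b\<in>A. d \<le> b}" "countable J"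
        and cov: "range g \<inter> (\<Union>b\<in>{b\<in>A. d \<le> b}. V b) \<subseteq> (\<Union>b\<in>J. V b)"
        using hereditarily_Lindelof_in_indexed[OF HL, of "{b\<in>A. d \<le> b}" V] V(1) by blast
      have "countable (insert d J)"
        using J(2) by simp
      then obtain d' where d': "\<And>b. b \<in> insert d J \<Longrightarrow> b < d'"
        using omega_one_countable_bounded by meson
      have "\<exists>b\<in>A. d \<le> b \<and> b < d' \<and> g i \<in> V b" if "i \<in> A" "d' \<le> i" for i
      proof -
        have "d \<le> i"
          using d'[of d] that(2) by simp
        then have "g i \<in> (\<Union>b\<in>J. V b)"
          using cov V(2)[of i] that(1) by blast
        then show ?thesis
          using J(1) d' by blast
      qed
      then show ?thesis by blast
    qed
    then obtain s where s: "\<And>d i. i \<in> A \<Longrightarrow> s d \<le> i \<Longrightarrow> \<exists>b\<in>A. d \<le> b \<and> b < s d \<and> g i \<in> V b"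
      by metis
    \<comment> \<open>Any starting point will do: only the blocks from \<open>d r\<close> up to \<open>d (Suc r)\<close> matter.\<close>
    define d where "d r = (s ^^ r) undefined" for r
    have "countable (\<Union>r. {..<d r})"
      using countable_lessThan_omega_one by (intro countable_UN) auto
    then have "\<not> A \<subseteq> (\<Union>r. {..<d r})"
      using n countable_subset unfolding A_def by blast
    then obtain i where "i \<in> A" "i \<notin> (\<Union>r. {..<d r})"
      by blast
    then have i: "i \<in> A" "\<And>r. d r \<le> i"
      by (auto simp: not_less)
    have "\<exists>b\<in>A. d r \<le> b \<and> b < d (Suc r) \<and> g i \<in> V b" for r
      using s[OF i(1), of "d r"] i(2)[of "Suc r"] by (simp add: d_def)
    then obtain b where b: "\<And>r. b r \<in> A" "\<And>r. d r \<le> b r" "\<And>r. b r < d (Suc r)" "\<And>r. g i \<in> V (b r)"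
      by metis
    have "strict_mono b"
      unfolding strict_mono_Suc_iff using b(2,3) less_le_trans by blast
    then have "infinite (range b)"
      using range_inj_infinite strict_mono_imp_inj_on by blast
    moreover have "range b \<subseteq> {b\<in>A. b < i \<and> g i \<in> V b}"
      using b(1,3,4) i(2) less_le_trans by blast
    ultimately show False
      using fin finite_subset by blast
  qed
  then show ?thesis
    using that by blast
qed

text \<open>
  Only the passage to the next colour is demanded, since this is what the inductive construction can
  give: it adds one point at a time as a limit of points of a single colour. Integer colours
  rather than natural numbers allow a ranking to be shifted so that a given point gets a given colour.
\<close>
definition ranked :: "'a topology \<Rightarrow> 'a set \<Rightarrow> ('a \<Rightarrow> int) \<Rightarrow> ('a \<Rightarrow> omega_one) \<Rightarrow> bool" where
  "ranked X Y c \<rho> \<longleftrightarrow>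
     (\<forall>y\<in>Y. \<forall>j<\<rho> y. y \<in> X closure_of {z \<in> Y. c z = c y + 1 \<and> j \<le> \<rho> z})"

definition reaches :: "'a topology \<Rightarrow> 'a set \<Rightarrow> 'a \<Rightarrow> omega_one \<Rightarrow> bool" where
  "reaches X Y y i \<longleftrightarrow> (\<exists>c \<rho>. ranked X Y c \<rho> \<and> i \<le> \<rho> y)"

lemma rankedD:
  "ranked X Y c \<rho> \<Longrightarrow> y \<in> Y \<Longrightarrow> j < \<rho> y \<Longrightarrow> y \<in> X closure_of {z \<in> Y. c z = c y + 1 \<and> j \<le> \<rho> z}"
  by (simp add: ranked_def)

abbreviation zero_omega_one :: omega_one where
  "zero_omega_one \<equiv> LEAST i. True"

lemma not_less_zero_omega_one: "\<not> i < zero_omega_one"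
  by (simp add: not_less Least_le)

lemma ranked_zero: "ranked X Y c (\<lambda>_. zero_omega_one)"
  by (simp add: ranked_def not_less_zero_omega_one)

lemma ranked_shift:
  assumes "ranked X Y c \<rho>" shows "ranked X Y (\<lambda>y. c y + t) \<rho>"
  using assms by (simp add: ranked_def algebra_simps)

text \<open>
  The condition on the other points survives because the sets of points of rank at least $j$ only grow.
\<close>
lemma ranked_raise:
  assumes rk: "ranked X Y c \<rho>" and "\<rho> p \<le> i"
    and lim: "\<And>j. j < i \<Longrightarrow> p \<in> X closure_of {z \<in> Y. c z = c p + 1 \<and> j \<le> \<rho> z}"
  shows "ranked X Y c (\<rho>(p := i))"
  unfolding ranked_def
proof (intro ballI allI impI)
  fix y j assume y: "y \<in> Y" "j < (\<rho>(p := i)) y"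
  have "y \<in> X closure_of {z \<in> Y. c z = c y + 1 \<and> j \<le> \<rho> z}"
    using rankedD[OF rk y(1)] lim y(2) by (cases "y = p") auto
  moreover have "{z \<in> Y. c z = c y + 1 \<and> j \<le> \<rho> z} \<subseteq> {z \<in> Y. c z = c y + 1 \<and> j \<le> (\<rho>(p := i)) z}"
    using assms(2) by auto
  ultimately show "y \<in> X closure_of {z \<in> Y. c z = c y + 1 \<and> j \<le> (\<rho>(p := i)) z}"
    using closure_of_mono by (metis (no_types, lifting) subsetD)
qed

lemma ranked_glue:
  fixes D :: "'b \<Rightarrow> 'a set"
  assumes dis: "\<And>a b. a \<noteq> b \<Longrightarrow> D a \<inter> D b = {}"
    and rk: "\<And>a. ranked X (D a) (c a) (\<rho> a)"
  obtains c' \<rho>' where "ranked X (\<Union>a. D a) c' \<rho>'"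
    and "\<And>a y. y \<in> D a \<Longrightarrow> c' y = c a y" and "\<And>a y. y \<in> D a \<Longrightarrow> \<rho>' y = \<rho> a y"
proof -
  define a where "a y = (THE a. y \<in> D a)" for y
  have a: "a y = b" if "y \<in> D b" for y b
    unfolding a_def using that dis by (intro the_equality) auto
  show ?thesis
  proof (rule that[of "\<lambda>y. c (a y) y" "\<lambda>y. \<rho> (a y) y"])
    show "ranked X (\<Union>a. D a) (\<lambda>y. c (a y) y) (\<lambda>y. \<rho> (a y) y)"
      unfolding ranked_def
    proof (intro ballI allI impI)
      fix y j assume "y \<in> (\<Union>a. D a)" and j: "j < \<rho> (a y) y"
      then have y: "y \<in> D (a y)"
        using a by auto
      have "{z \<in> D (a y). c (a y) z = c (a y) y + 1 \<and> j \<le> \<rho> (a y) z}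
          \<subseteq> {z \<in> \<Union>(range D). c (a z) z = c (a y) y + 1 \<and> j \<le> \<rho> (a z) z}"
        using a by fastforce
      from closure_of_mono[OF this] rankedD[OF rk y j]
      show "y \<in> X closure_of {z \<in> \<Union>(range D). c (a z) z = c (a y) y + 1 \<and> j \<le> \<rho> (a z) z}"
        by (rule subsetD)
    qed
  qed (simp_all add: a)
qed

lemma reaches_mono:
  assumes "reaches X Y y i" and "Y \<subseteq> Y'" and "y \<in> Y"
  shows "reaches X Y' y i"
proof -
  obtain c \<rho> where rk: "ranked X Y c \<rho>" "i \<le> \<rho> y"
    using assms(1) by (auto simp: reaches_def)
  let ?\<rho> = "\<lambda>z. if z \<in> Y then \<rho> z else zero_omega_one"
  have "ranked X Y' c ?\<rho>"
    unfolding ranked_def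
  proof (intro ballI allI impI)
    fix y j assume "j < ?\<rho> y"
    then have "y \<in> Y" "j < \<rho> y"
      by (auto simp: not_less_zero_omega_one split: if_splits)
    note rankedD[OF rk(1) this]
    moreover have "{z \<in> Y. c z = c y + 1 \<and> j \<le> \<rho> z} \<subseteq> {z \<in> Y'. c z = c y + 1 \<and> j \<le> ?\<rho> z}"
      using assms(2) by auto
    ultimately show "y \<in> X closure_of {z \<in> Y'. c z = c y + 1 \<and> j \<le> ?\<rho> z}"
      using closure_of_mono by (metis (no_types, lifting) subsetD)
  qed
  moreover have "i \<le> ?\<rho> y"
    using rk(2) assms(3) by simp
  ultimately show ?thesis
    unfolding reaches_def by blast
qed

text \<open>
  By the induction hypothesis, applied to the set of exceptions, all but countably many points of any
  uncountable subset reach each rank $j < i$. So $Y$ contains $\omega_1$ disjoint pieces $D_a$ with points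
  $y_a \in D_a$ that reach all ranks below $i$. Each piece has to commit to one of these ranks, $n(a)$, and
  the task is to do so in such a way that some $y_b$ is a limit of $\{y_a : n(a) \geq j\}$ for
  every $j < i$; then the rank of $y_b$ can be raised to $i$. The countably many $j < i$ are enumerated
  as $w_0, w_1, \ldots$, and $n(a)$ is the largest among $w_0, \ldots, w_{m(a)}$, where $m$ is unbounded
  near $y_b$.
\<close>
lemma reaches_every_rank:
  assumes HL: "hereditarily_Lindelof_in X Y" and "uncountable Y"
  shows "\<exists>y\<in>Y. reaches X Y y i"
  using assms
proof (induction i arbitrary: Y rule: less_induct)
  case (less i)
  have sub: "Y \<subseteq> topspace X"
    using less.prems(1) by (simp add: hereditarily_Lindelof_in_def)
  have small: "countable {y \<in> B. \<not> reaches X B y j}" if "j < i" "B \<subseteq> Y" for j B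
  proof (rule ccontr)
    let ?C = "{y \<in> B. \<not> reaches X B y j}"
    assume unc: "uncountable ?C"
    have "hereditarily_Lindelof_in X ?C"
      by (rule hereditarily_Lindelof_in_subset[OF less.prems(1)]) (use that(2) in auto)
    from less.IH[OF that(1) this unc] obtain y where "y \<in> ?C" "reaches X ?C y j"
      by (rule bexE)
    then show False
      using reaches_mono[of X ?C y j B] by auto
  qed
  obtain g :: "omega_one \<times> omega_one \<Rightarrow> 'a" where g: "inj g" "range g \<subseteq> Y"
    using omega_one_pairs_embed[OF less.prems(2)] .
  define D where "D a = range (\<lambda>b. g (a, b))" for a
  have DY: "D a \<subseteq> Y" for a
    using g(2) by (auto simp: D_def)
  have dis: "D a \<inter> D b = {}" if "a \<noteq> b" for a b
    using that g(1) by (auto simp: D_def inj_def)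
  have "\<exists>y\<in>D a. \<forall>j<i. reaches X (D a) y j" for a
  proof (rule ccontr)
    assume "\<not> ?thesis"
    then have "D a \<subseteq> (\<Union>j\<in>{..<i}. {y \<in> D a. \<not> reaches X (D a) y j})" by auto
    moreover have "countable (\<Union>j\<in>{..<i}. {y \<in> D a. \<not> reaches X (D a) y j})"
      using small DY countable_lessThan_omega_one by (intro countable_UN) auto
    ultimately have "countable (D a)"
      using countable_subset by blast
    moreover have "inj (\<lambda>b. g (a, b))"
      using g(1) by (auto simp: inj_def)
    ultimately show False
      using uncountable_omega_one unfolding D_def by (metis countable_image_inj_on)
  qed
  then obtain y where yD: "\<And>a. y a \<in> D a" and y: "\<And>a j. j < i \<Longrightarrow> reaches X (D a) (y a) j"
    by metis
  have "hereditarily_Lindelof_in X (range y)"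
    by (rule hereditarily_Lindelof_in_subset[OF less.prems(1)]) (use yD DY in auto)
  then obtain b and m :: "omega_one \<Rightarrow> nat"
    where m: "\<And>V k. openin X V \<Longrightarrow> y b \<in> V \<Longrightarrow> \<exists>i. y i \<in> V \<and> k < m i"
    using hereditarily_Lindelof_in_unbounded_function by metis
  have "y b \<in> topspace X"
    using yD DY sub by blast
  have "reaches X (\<Union>a. D a) (y b) i"
  proof (cases "{..<i} = {}")
    case True
    then have "ranked X (\<Union>a. D a) (\<lambda>_. 0) (\<lambda>_. i)"
      by (auto simp: ranked_def)
    then show ?thesis
      unfolding reaches_def by blast
  next
    case False
    define w where "w = from_nat_into {..<i}"
    have w: "range w = {..<i}"
      unfolding w_def using False countable_lessThan_omega_one by (rule range_from_nat_into)
    define n where "n a = Max (w ` {..m a})" for a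
    \<comment> \<open>The piece of the limit point gets a trivial ranking, so that raising the rank of this point is allowed.\<close>
    have "\<exists>c \<rho>. ranked X (D a) c \<rho> \<and> (a \<noteq> b \<longrightarrow> c (y a) = 1 \<and> n a \<le> \<rho> (y a))
            \<and> (a = b \<longrightarrow> c (y a) = 0 \<and> \<rho> (y a) \<le> i)" for a
    proof (cases "a = b")
      case True
      then show ?thesis
        using ranked_zero[of X "D a" "\<lambda>_. 0"]
        by (intro exI[of _ "\<lambda>_. 0"] exI[of _ "\<lambda>_. zero_omega_one"]) (simp add: Least_le)
    next
      case False
      have "n a \<in> w ` {..m a}"
        unfolding n_def by (rule Max_in) auto
      then have "n a < i"
        using w by auto
      then obtain c \<rho> where "ranked X (D a) c \<rho>" "n a \<le> \<rho> (y a)"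
        using y[of "n a" a] by (auto simp: reaches_def)
      then show ?thesis
        using ranked_shift[of X "D a" c \<rho> "1 - c (y a)"] False
        by (intro exI[of _ "\<lambda>z. c z + (1 - c (y a))"] exI[of _ \<rho>]) simp
    qed
    then obtain c \<rho> where rk: "\<And>a. ranked X (D a) (c a) (\<rho> a)"
      and far: "\<And>a. a \<noteq> b \<Longrightarrow> c a (y a) = 1 \<and> n a \<le> \<rho> a (y a)"
      and near: "c b (y b) = 0" "\<rho> b (y b) \<le> i"
      by metis
    obtain c' \<rho>' where rk': "ranked X (\<Union>a. D a) c' \<rho>'"
      and c': "\<And>a. c' (y a) = c a (y a)" and \<rho>': "\<And>a. \<rho>' (y a) = \<rho> a (y a)"
      using ranked_glue[of D X c \<rho>, OF dis rk] yD by metis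
    have "ranked X (\<Union>a. D a) c' (\<rho>'(y b := i))"
    proof (rule ranked_raise[OF rk'])
      show "\<rho>' (y b) \<le> i"
        using near(2) \<rho>' by simp
      fix j assume "j < i"
      then obtain k where k: "j = w k"
        using w by (metis lessThan_iff rangeE)
      show "y b \<in> X closure_of {z \<in> \<Union>a. D a. c' z = c' (y b) + 1 \<and> j \<le> \<rho>' z}"
      proof (rule closure_ofI)
        show "y b \<in> topspace X" by fact
        fix V assume "openin X V" "y b \<in> V"
        then obtain a where a: "y a \<in> V" "max k (m b) < m a"
          using m by blast
        then have "a \<noteq> b" by auto
        have "w k \<le> n a"
          unfolding n_def using a(2) by (intro Max_ge) auto
        then have "j \<le> \<rho>' (y a)"
          using far[OF \<open>a \<noteq> b\<close>] k \<rho>'[of a] by (metis order_trans)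
        then show "\<exists>z\<in>{z \<in> \<Union>a. D a. c' z = c' (y b) + 1 \<and> j \<le> \<rho>' z}. z \<in> V"
          using a(1) far[OF \<open>a \<noteq> b\<close>] near(1) c' yD by (intro bexI[of _ "y a"]) auto
      qed
    qed
    then show ?thesis
      unfolding reaches_def by (metis fun_upd_same order_refl)
  qed
  moreover have "(\<Union>a. D a) \<subseteq> Y"
    using DY by blast
  ultimately show ?case
    using reaches_mono yD by (metis UN_I UNIV_I subsetD)
qed

text \<open>
  The decreasing closures of the sets $P_j$ of points of rank at least $j$ stabilise at some $j_0$ by the
  Lindelof property. Any open set meeting $P_{j_0}$ then contains a point of rank greater than
  or equal to $j_0 + \omega$, and from there one climbs to any higher colour in finitely many steps while staying
  in $P_{j_0}$.
\<close>
theorem hereditarily_Lindelof_in_contains_\<omega>_resolvable: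
  assumes HL: "hereditarily_Lindelof_in X A" and "uncountable A"
  obtains P where "P \<subseteq> A" "P \<noteq> {}" "\<omega>_resolvable_in X P"
proof -
  have AX: "A \<subseteq> topspace X"
    using HL by (simp add: hereditarily_Lindelof_in_def)
  obtain g :: "omega_one \<times> omega_one \<Rightarrow> 'a" where g: "inj g" "range g \<subseteq> A"
    using omega_one_pairs_embed[OF assms(2)] .
  define D where "D a = range (\<lambda>b. g (a, b))" for a
  have DA: "D a \<subseteq> A" for a
    using g(2) by (auto simp: D_def)
  have dis: "D a \<inter> D b = {}" if "a \<noteq> b" for a b
    using that g(1) by (auto simp: D_def inj_def)
  have "\<exists>y\<in>D a. reaches X (D a) y a" for a
  proof (rule reaches_every_rank)
    show "hereditarily_Lindelof_in X (D a)"
      using HL DA by (rule hereditarily_Lindelof_in_subset)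
    have "inj (\<lambda>b. g (a, b))"
      using g(1) by (auto simp: inj_def)
    then show "uncountable (D a)"
      using uncountable_omega_one unfolding D_def by (metis countable_image_inj_on)
  qed
  then obtain y where yD: "\<And>a. y a \<in> D a" and "\<And>a. reaches X (D a) (y a) a"
    by metis
  then obtain c \<rho> where "\<And>a. ranked X (D a) (c a) (\<rho> a)" and y: "\<And>a. a \<le> \<rho> a (y a)"
    unfolding reaches_def by metis
  then obtain c' \<rho>' where rk: "ranked X (\<Union>a. D a) c' \<rho>'" and y': "\<And>a. a \<le> \<rho>' (y a)"
    using ranked_glue[of D X c \<rho>, OF dis] yD by metis
  define Y where "Y = (\<Union>a. D a)"
  have YA: "Y \<subseteq> A"
    using DA by (auto simp: Y_def)
  then have YX: "Y \<subseteq> topspace X"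
    using AX by simp
  have yY: "y a \<in> Y" for a
    using yD[of a] by (auto simp: Y_def)
  define P where "P j = {z \<in> Y. j \<le> \<rho>' z}" for j
  have PY: "P j \<subseteq> Y" for j
    by (auto simp: P_def)
  have P_ne: "P j \<noteq> {}" for j
    using y'[of j] yY[of j] by (auto simp: P_def)
  obtain J where J: "countable J"
    "A \<inter> (\<Union>j\<in>UNIV. topspace X - X closure_of P j) \<subseteq> (\<Union>j\<in>J. topspace X - X closure_of P j)"
    using hereditarily_Lindelof_in_indexed[OF HL, of UNIV "\<lambda>j. topspace X - X closure_of P j"]
    by (metis openin_diff openin_topspace closedin_closure_of)
  obtain j0 where j0: "\<And>j. j \<in> J \<Longrightarrow> j < j0"
    using omega_one_countable_bounded[OF J(1)] by blast
  have stable: "P j0 \<subseteq> X closure_of P j" for j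
  proof
    fix x assume x: "x \<in> P j0"
    show "x \<in> X closure_of P j"
    proof (rule ccontr)
      assume "x \<notin> X closure_of P j"
      then have "x \<in> A \<inter> (\<Union>j\<in>UNIV. topspace X - X closure_of P j)"
        using x PY YA YX by blast
      then obtain j' where j': "j' \<in> J" "x \<notin> X closure_of P j'"
        using J(2) by blast
      have "P j0 \<subseteq> P j'"
        using j0[OF j'(1)] by (auto simp: P_def)
      then have "x \<in> P j'"
        using x by blast
      then show False
        using j'(2) closure_of_subset[of "P j'" X] PY YX by blast
    qed
  qed
  have "\<forall>j :: omega_one. \<exists>k. j < k"
    using omega_one_countable_bounded[of "{j}" for j] by simp
  then obtain s :: "omega_one \<Rightarrow> omega_one" where s: "\<And>j. j < s j"
    by metis
  \<comment> \<open>Each climbing step costs one term of this sequence; \<open>t\<close> leaves room for any number of steps.\<close>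
  define d where "d n = (s ^^ n) j0" for n
  have d: "d n < d (Suc n)" for n
    using s by (simp add: d_def)
  have d0: "j0 \<le> d n" for n
    by (induction n) (use d in \<open>auto simp: d_def less_imp_le intro: order_trans\<close>)
  obtain t where t: "\<And>n. d n < t"
    using omega_one_countable_bounded[of "range d"] by auto
  have "\<omega>_resolvable_in X (P j0)"
  proof (rule \<omega>_resolvable_in_if_eventually_all_colours[where c = "\<lambda>z. nat (c' z)"])
    show "P j0 \<subseteq> topspace X"
      using PY YX by blast
    fix V assume V: "openin X V" "V \<inter> P j0 \<noteq> {}"
    then obtain x where x: "x \<in> V" "x \<in> X closure_of P t"
      using stable by blast
    obtain z where z: "z \<in> P t" "z \<in> V"
      using closure_ofD[OF x(2) V(1) x(1)] by blast
    have climb: "\<exists>z'\<in>V \<inter> Y. c' z' = c' z + int k \<and> d n \<le> \<rho>' z'" for k n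
    proof (induction k arbitrary: n)
      case 0
      have "d n \<le> \<rho>' z"
        using t[of n] z(1) by (auto simp: P_def)
      then show ?case
        using z PY by (intro bexI[of _ z]) auto
    next
      case (Suc k)
      obtain z' where z': "z' \<in> V" "z' \<in> Y" "c' z' = c' z + int k" "d (Suc n) \<le> \<rho>' z'"
        using Suc.IH[of "Suc n"] by auto
      have "d n < \<rho>' z'"
        using d[of n] z'(4) by simp
      then have "z' \<in> X closure_of {u \<in> Y. c' u = c' z' + 1 \<and> d n \<le> \<rho>' u}"
        using rankedD[OF rk, of z' "d n"] z'(2) by (simp add: Y_def)
      from closure_ofD[OF this V(1) z'(1)]
      obtain u where "u \<in> Y" "c' u = c' z' + 1" "d n \<le> \<rho>' u" "u \<in> V"
        by auto
      then show ?case
        using z'(3) by (intro bexI[of _ u]) auto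
    qed
    have "\<exists>u\<in>V \<inter> P j0. nat (c' u) = n" if "n \<ge> nat (c' z)" for n
    proof -
      obtain u where u: "u \<in> V" "u \<in> Y" "c' u = c' z + int (nat (int n - c' z))" "d 0 \<le> \<rho>' u"
        using climb[of "nat (int n - c' z)" 0] by auto
      then have "nat (c' u) = n"
        using that by simp
      moreover have "u \<in> P j0"
        using u(2,4) d0[of 0] by (auto simp: P_def)
      ultimately show ?thesis
        using u(1) by (intro bexI[of _ u]) auto
    qed
    then show "\<exists>N. \<forall>n\<ge>N. \<exists>u\<in>V \<inter> P j0. nat (c' u) = n"
      by (intro exI[of _ "nat (c' z)"]) simp
  qed
  then show ?thesis
    using that[of "P j0"] P_ne PY YA by blast
qed


section \<open>Discrete subsets and their limits\<close>

definition discrete_in :: "'a topology \<Rightarrow> 'a set \<Rightarrow> bool" where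
  "discrete_in X D \<longleftrightarrow> (\<forall>d\<in>D. \<exists>U. openin X U \<and> U \<inter> D = {d})"

definition discrete_limits :: "'a topology \<Rightarrow> 'a set \<Rightarrow> 'a set" where
  "discrete_limits X Z = {z \<in> Z. \<exists>D\<subseteq>Z. discrete_in X D \<and> z \<notin> D \<and> z \<in> X closure_of D}"

lemma discrete_in_subset:
  assumes "discrete_in X D" and "E \<subseteq> D"
  shows "discrete_in X E"
  unfolding discrete_in_def
proof
  fix d assume "d \<in> E"
  then obtain U where "openin X U" "U \<inter> D = {d}"
    using assms unfolding discrete_in_def by (metis subsetD)
  then show "\<exists>U. openin X U \<and> U \<inter> E = {d}"
    using assms(2) \<open>d \<in> E\<close> by (intro exI[of _ U]) auto
qed

lemma discrete_in_subset_topspace: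
  assumes "discrete_in X D" shows "D \<subseteq> topspace X"
proof
  fix d assume "d \<in> D"
  then obtain U where "openin X U" "U \<inter> D = {d}"
    using assms unfolding discrete_in_def by meson
  then show "d \<in> topspace X"
    using openin_subset[of X U] by auto
qed

lemma countable_if_discrete_in_Lindelof:
  assumes AX: "A \<subseteq> topspace X" and L: "Lindelof_space (subtopology X A)"
    and "D \<subseteq> A" and D: "discrete_in X D" and cl: "A \<inter> X closure_of D \<subseteq> D"
  shows "countable D"
proof -
  have "\<exists>U. openin X U \<and> a \<in> U \<and> U \<inter> D \<subseteq> {a}" if "a \<in> A" for a
  proof (cases "a \<in> D")
    case True
    then obtain U where "openin X U" "U \<inter> D = {a}"
      using D unfolding discrete_in_def by meson
    then show ?thesis
      by (intro exI[of _ U]) auto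
  next
    case False
    then have "a \<notin> X closure_of D" "a \<in> topspace X"
      using cl AX that by auto
    then show ?thesis
      unfolding in_closure_of by blast
  qed
  then obtain U where U: "\<And>a. a \<in> A \<Longrightarrow> openin X (U a)" "\<And>a. a \<in> A \<Longrightarrow> a \<in> U a"
    "\<And>a. a \<in> A \<Longrightarrow> U a \<inter> D \<subseteq> {a}"
    by metis
  have "(\<forall>V\<in>U ` A. openin X V) \<and> A \<subseteq> \<Union>(U ` A)"
    using U(1,2) by auto
  then obtain \<V> where \<V>: "countable \<V>" "\<V> \<subseteq> U ` A" "A \<subseteq> \<Union>\<V>"
    using L[unfolded Lindelof_space_subtopology_subset[OF AX]] by meson
  then obtain J where J: "countable J" "J \<subseteq> A" "\<V> = U ` J"
    using countable_subset_image[of \<V> U A] by auto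
  have "D \<subseteq> J"
  proof
    fix d assume "d \<in> D"
    then obtain j where "j \<in> J" "d \<in> U j"
      using \<V>(3) J(3) \<open>D \<subseteq> A\<close> by auto
    then show "d \<in> J"
      using U(3)[of j] J(2) \<open>d \<in> D\<close> by auto
  qed
  then show ?thesis
    using J(1) countable_subset by blast
qed

text \<open>
  From a well-ordered family $\mathcal U$ choose, for each member that is the first one containing some
  point of $A$, such a point. The chosen points form a right-separated set $R$: no member
  contains a point chosen for a later member. Hence in every non-empty relatively open subset of $R$ the
  earliest point is isolated, and the isolated points are dense in $R$; they form a discrete set, which by
  hypothesis is closed in $A$. So it is all of $R$, and it is countable as $A$ is Lindelof.
\<close>
lemma hereditarily_Lindelof_in_if_no_discrete_limits:
  assumes AX: "A \<subseteq> topspace X" and L: "Lindelof_space (subtopology X A)"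
    and cl: "\<And>D. D \<subseteq> A \<Longrightarrow> discrete_in X D \<Longrightarrow> A \<inter> X closure_of D \<subseteq> D"
  shows "hereditarily_Lindelof_in X A"
  unfolding hereditarily_Lindelof_in_def
proof (intro conjI allI impI)
  show "A \<subseteq> topspace X" by fact
  fix \<U> assume \<U>: "\<forall>U\<in>\<U>. openin X U"
  obtain r :: "'a set rel" where "well_order_on UNIV r"
    using well_order_on by blast
  then have wf: "wf (r - Id)" and antisym: "antisym r" and total: "total_on UNIV r" and refl: "refl_on UNIV r"
    by (auto simp: well_order_on_def linear_order_on_def partial_order_on_def preorder_on_def)
  have least: "\<exists>U\<in>\<S>. \<forall>V\<in>\<S>. (U, V) \<in> r" if "\<S> \<noteq> {}" for \<S>
  proof -
    obtain S where "S \<in> \<S>"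
      using \<open>\<S> \<noteq> {}\<close> by blast
    then obtain U where U: "U \<in> \<S>" "\<And>V. (V, U) \<in> r - Id \<Longrightarrow> V \<notin> \<S>"
      using wfE_min[OF wf] by metis
    have "(U, V) \<in> r" if "V \<in> \<S>" for V
      using U(2)[of V] that total refl by (cases "U = V") (auto simp: total_on_def refl_on_def)
    then show ?thesis
      using U(1) by blast
  qed
  have "\<exists>U. U \<in> \<U> \<and> b \<in> U \<and> (\<forall>V\<in>\<U>. b \<in> V \<longrightarrow> (U, V) \<in> r)" if "b \<in> A \<inter> \<Union>\<U>" for b
    using least[of "{U \<in> \<U>. b \<in> U}"] that by auto
  then obtain l where l: "\<And>b. b \<in> A \<inter> \<Union>\<U> \<Longrightarrow> l b \<in> \<U>" "\<And>b. b \<in> A \<inter> \<Union>\<U> \<Longrightarrow> b \<in> l b"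
    "\<And>b V. b \<in> A \<inter> \<Union>\<U> \<Longrightarrow> V \<in> \<U> \<Longrightarrow> b \<in> V \<Longrightarrow> (l b, V) \<in> r"
    by metis
  define \<W> where "\<W> = l ` (A \<inter> \<Union>\<U>)"
  have "\<forall>U\<in>\<W>. \<exists>b. b \<in> A \<inter> \<Union>\<U> \<and> l b = U"
    by (auto simp: \<W>_def)
  then obtain p where p: "\<And>U. U \<in> \<W> \<Longrightarrow> p U \<in> A \<inter> \<Union>\<U>" "\<And>U. U \<in> \<W> \<Longrightarrow> l (p U) = U"
    by metis
  have \<W>\<U>: "\<W> \<subseteq> \<U>"
    using l(1) by (auto simp: \<W>_def)
  have pU: "p U \<in> U" if "U \<in> \<W>" for U
    using l(2)[OF p(1)[OF that]] p(2)[OF that] by simp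
  define R where "R = p ` \<W>"
  have RA: "R \<subseteq> A"
    using p(1) by (auto simp: R_def)
  define D where "D = {x \<in> R. \<exists>U. openin X U \<and> U \<inter> R = {x}}"
  have disc: "discrete_in X D"
    unfolding discrete_in_def
  proof
    fix d assume d: "d \<in> D"
    then obtain U where "openin X U" "U \<inter> R = {d}"
      by (auto simp: D_def)
    then show "\<exists>U. openin X U \<and> U \<inter> D = {d}"
      using d by (intro exI[of _ U]) (auto simp: D_def)
  qed
  have "R \<subseteq> X closure_of D"
  proof (rule subsetI, rule closure_ofI)
    fix x V assume x: "x \<in> R" and V: "openin X V" "x \<in> V"
    then have "{U \<in> \<W>. p U \<in> V} \<noteq> {}"
      by (auto simp: R_def)
    from least[OF this] obtain U where U: "U \<in> \<W>" "p U \<in> V"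
      and min: "\<And>W. W \<in> \<W> \<Longrightarrow> p W \<in> V \<Longrightarrow> (U, W) \<in> r"
      by auto
    have "W = U" if W: "W \<in> \<W>" "p W \<in> V" "p W \<in> U" for W
    proof -
      have "(l (p W), U) \<in> r"
        using l(3)[OF p(1)[OF W(1)]] W(3) U(1) \<W>\<U> by blast
      then have "(W, U) \<in> r"
        using p(2)[OF W(1)] by simp
      then show ?thesis
        using min[OF W(1,2)] antisym by (meson antisymD)
    qed
    then have "(V \<inter> U) \<inter> R = {p U}"
      using U pU by (auto simp: R_def)
    moreover have "openin X (V \<inter> U)"
      using V(1) U(1) \<U> \<W>\<U> by auto
    moreover have "p U \<in> R"
      using U(1) by (auto simp: R_def)
    ultimately have "p U \<in> D"
      by (auto simp: D_def)
    then show "\<exists>y\<in>D. y \<in> V"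
      using U(2) by blast
  qed (use RA AX in blast)
  moreover have "D \<subseteq> R"
    by (auto simp: D_def)
  ultimately have "R = D"
    using cl[OF _ disc] RA by auto
  then have "countable R"
    using countable_if_discrete_in_Lindelof[OF AX L] cl[OF _ disc] disc RA by auto
  moreover have "\<W> = l ` R"
    using p(2) by (force simp: R_def)
  ultimately have "countable \<W>" by simp
  moreover have "A \<inter> \<Union>\<U> \<subseteq> \<Union>\<W>"
    using l(2) by (auto simp: \<W>_def)
  ultimately show "\<exists>\<V>\<subseteq>\<U>. countable \<V> \<and> A \<inter> \<Union>\<U> \<subseteq> \<Union>\<V>"
    using \<W>\<U> by blast
qed

definition thick_in :: "'a topology \<Rightarrow> 'a set \<Rightarrow> bool" where
  "thick_in X Z \<longleftrightarrow> Z \<subseteq> topspace X \<and> (\<forall>U. openin X U \<and> U \<inter> Z \<noteq> {} \<longrightarrow> uncountable (U \<inter> Z))"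

text \<open>
  If no $\omega$-resolvable subspace exists, all Lindelof subsets of $Y$ are hereditarily Lindelof and
  therefore countable. Then every countable $C \subseteq Y$ is in the closure of a countable set disjoint
  from $C$, as $Y - C$ is dense in $Y$; iterating $C \mapsto C \cup E(C)$ gives the sequence.
\<close>
lemma \<omega>_resolvable_if_thick_without_discrete_limits:
  assumes tight: "L_tight X" and thick: "thick_in X Y" and "Y \<noteq> {}"
    and cl: "discrete_limits X Y = {}"
  obtains P where "P \<subseteq> Y" "P \<noteq> {}" "\<omega>_resolvable_in X P"
proof (rule ccontr)
  assume "\<not> thesis"
  then have no: "\<And>P. P \<subseteq> Y \<Longrightarrow> P \<noteq> {} \<Longrightarrow> \<not> \<omega>_resolvable_in X P"
    using that by blast
  have YX: "Y \<subseteq> topspace X"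
    using thick by (simp add: thick_in_def)
  have small: "countable B" if "B \<subseteq> Y" "Lindelof_space (subtopology X B)" for B
  proof (rule ccontr)
    assume unc: "uncountable B"
    have "B \<inter> X closure_of D \<subseteq> D" if "D \<subseteq> B" "discrete_in X D" for D
      using cl that \<open>B \<subseteq> Y\<close> unfolding discrete_limits_def by blast
    then have "hereditarily_Lindelof_in X B"
      using that YX by (intro hereditarily_Lindelof_in_if_no_discrete_limits) auto
    then obtain P where "P \<subseteq> B" "P \<noteq> {}" "\<omega>_resolvable_in X P"
      using hereditarily_Lindelof_in_contains_\<omega>_resolvable unc by metis
    then show False
      using no[of P] \<open>B \<subseteq> Y\<close> by auto
  qed
  have "\<exists>E. countable E \<and> E \<subseteq> Y - C \<and> C \<subseteq> X closure_of E" if C: "countable C" "C \<subseteq> Y" for C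
  proof -
    have "\<exists>B. countable B \<and> B \<subseteq> Y - C \<and> y \<in> X closure_of B" if "y \<in> C" for y
    proof -
      have "y \<in> X closure_of (Y - C)"
      proof (rule closure_ofI)
        show "y \<in> topspace X"
          using that C(2) YX by blast
        fix V assume "openin X V" "y \<in> V"
        then have "uncountable (V \<inter> Y)"
          using thick that C(2) unfolding thick_in_def by blast
        then have "\<not> V \<inter> Y \<subseteq> C"
          using C(1) countable_subset by blast
        then show "\<exists>z\<in>Y - C. z \<in> V" by blast
      qed
      moreover have "Y - C \<subseteq> topspace X"
        using YX by blast
      ultimately obtain B where "B \<subseteq> Y - C" "Lindelof_space (subtopology X B)" "y \<in> X closure_of B"
        using tight unfolding L_tight_def by meson
      then show ?thesis
        using small[of B] by blast
    qed
    then obtain B where B: "\<And>y. y \<in> C \<Longrightarrow> countable (B y)" "\<And>y. y \<in> C \<Longrightarrow> B y \<subseteq> Y - C"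
      "\<And>y. y \<in> C \<Longrightarrow> y \<in> X closure_of B y"
      by metis
    have "countable (\<Union>y\<in>C. B y)"
      using C(1) B(1) by simp
    moreover have "(\<Union>y\<in>C. B y) \<subseteq> Y - C"
      using B(2) by blast
    moreover have "C \<subseteq> X closure_of (\<Union>y\<in>C. B y)"
    proof
      fix y assume y: "y \<in> C"
      then have "X closure_of B y \<subseteq> X closure_of (\<Union>y\<in>C. B y)"
        by (intro closure_of_mono) blast
      then show "y \<in> X closure_of (\<Union>y\<in>C. B y)"
        using B(3)[OF y] by (rule subsetD)
    qed
    ultimately show ?thesis by blast
  qed
  then obtain E where E: "\<And>C. countable C \<Longrightarrow> C \<subseteq> Y \<Longrightarrow> countable (E C)"
    "\<And>C. countable C \<Longrightarrow> C \<subseteq> Y \<Longrightarrow> E C \<subseteq> Y - C"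
    "\<And>C. countable C \<Longrightarrow> C \<subseteq> Y \<Longrightarrow> C \<subseteq> X closure_of E C"
    by metis
  obtain y where "y \<in> Y" using \<open>Y \<noteq> {}\<close> by blast
  define C where "C n = ((\<lambda>C. C \<union> E C) ^^ n) {y}" for n
  have C_Suc: "C (Suc n) = C n \<union> E (C n)" for n
    by (simp add: C_def)
  have C: "countable (C n) \<and> C n \<subseteq> Y" for n
  proof (induction n)
    case 0
    then show ?case using \<open>y \<in> Y\<close> by (simp add: C_def)
  next
    case (Suc n)
    then show ?case using E(1,2)[of "C n"] by (auto simp: C_Suc)
  qed
  have C_mono: "C m \<subseteq> C n" if "m \<le> n" for m n
    using that by (rule lift_Suc_mono_le[rotated]) (simp add: C_Suc)
  have EY: "E (C n) \<subseteq> Y - C n" for n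
    using E(2)[of "C n"] C[of n] by simp
  have cl_E: "C n \<subseteq> X closure_of E (C n)" for n
    using E(3)[of "C n"] C[of n] by simp
  have "\<omega>_resolvable_in X (\<Union>n. E (C n))"
  proof (rule \<omega>_resolvable_in_UN_sequence)
    show "E (C n) \<subseteq> topspace X" for n
      using EY YX by blast
    show "E (C m) \<inter> E (C n) = {}" if "m < n" for m n
      using C_mono[of "Suc m" n] C_Suc[of m] EY[of n] that by auto
    show "E (C n) \<subseteq> X closure_of E (C (Suc n))" for n
      using cl_E[of "Suc n"] C_Suc[of n] by blast
  qed
  moreover have "(\<Union>n. E (C n)) \<subseteq> Y"
    using EY by blast
  moreover have "E (C 0) \<noteq> {}"
    using cl_E[of 0] by (auto simp: C_def)
  ultimately show False
    using no[of "\<Union>n. E (C n)"] by blast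
qed

lemma discrete_limits_Int_open:
  assumes "openin X U"
  shows "U \<inter> discrete_limits X Z \<subseteq> discrete_limits X (U \<inter> Z)"
proof
  fix z assume z: "z \<in> U \<inter> discrete_limits X Z"
  then obtain D where D: "D \<subseteq> Z" "discrete_in X D" "z \<notin> D" "z \<in> X closure_of D"
    by (auto simp: discrete_limits_def)
  have "discrete_in X (U \<inter> D)"
    using D(2) by (rule discrete_in_subset) simp
  moreover have "z \<in> X closure_of (U \<inter> D)"
    using openin_Int_closure_of_subset[OF assms, of D] z D(4) by blast
  ultimately show "z \<in> discrete_limits X (U \<inter> Z)"
    using z D(1,3) unfolding discrete_limits_def by blast
qed

text \<open>
  Enumerate $E$, choose neighbourhoods whose closures contain only one point of $E$, and subtract from
  each the closures of the finitely many earlier ones.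
\<close>
lemma countable_discrete_in_disjoint_open_expansion:
  assumes reg: "regular_space X" and "countable E" and E: "discrete_in X E"
  obtains V where "\<And>e. e \<in> E \<Longrightarrow> openin X (V e)" "\<And>e. e \<in> E \<Longrightarrow> e \<in> V e"
    and "\<And>e f. e \<in> E \<Longrightarrow> f \<in> E \<Longrightarrow> e \<noteq> f \<Longrightarrow> V e \<inter> V f = {}"
proof -
  have "\<exists>W. openin X W \<and> e \<in> W \<and> X closure_of W \<inter> E \<subseteq> {e}" if e: "e \<in> E" for e
  proof -
    obtain U where U: "openin X U" "U \<inter> E = {e}"
      using E e unfolding discrete_in_def by meson
    then have "closedin X (topspace X - U)" "e \<in> topspace X - (topspace X - U)"
      using openin_subset[OF U(1)] by auto
    then obtain W where W: "openin X W" "e \<in> W" "disjnt (topspace X - U) (X closure_of W)"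
      using reg unfolding regular_space by meson
    then have "X closure_of W \<subseteq> U"
      using closure_of_subset_topspace[of X W] by (auto simp: disjnt_def)
    then show ?thesis
      using W(1,2) U(2) by (intro exI[of _ W]) auto
  qed
  then obtain W where W: "\<And>e. e \<in> E \<Longrightarrow> openin X (W e)" "\<And>e. e \<in> E \<Longrightarrow> e \<in> W e"
    "\<And>e. e \<in> E \<Longrightarrow> X closure_of W e \<inter> E \<subseteq> {e}"
    by metis
  define idx where "idx = to_nat_on E"
  have idx: "inj_on idx E"
    unfolding idx_def using assms(2) by (rule inj_on_to_nat_on)
  define V where "V e = W e - (\<Union>f\<in>{f\<in>E. idx f < idx e}. X closure_of W f)" for e
  show ?thesis
  proof (rule that[of V])
    fix e assume e: "e \<in> E"
    have "finite {f\<in>E. idx f < idx e}"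
    proof (rule finite_imageD[of idx])
      show "finite (idx ` {f\<in>E. idx f < idx e})"
        by (rule finite_subset[of _ "{..<idx e}"]) auto
      show "inj_on idx {f\<in>E. idx f < idx e}"
        using idx by (rule inj_on_subset) auto
    qed
    then have "closedin X (\<Union>f\<in>{f\<in>E. idx f < idx e}. X closure_of W f)"
      by (intro closedin_Union) auto
    then show "openin X (V e)"
      unfolding V_def using W(1)[OF e] by (rule openin_diff[rotated])
    show "e \<in> V e"
      using W(2)[OF e] W(3) e by (auto simp: V_def)
  next
    have *: "V e \<inter> V f = {}" if "e \<in> E" "f \<in> E" "idx e < idx f" for e f
    proof -
      have "W e \<subseteq> X closure_of W e"
        using W(1)[OF that(1)] by (intro closure_of_subset openin_subset)
      then show ?thesis
        using that by (auto simp: V_def)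
    qed
    fix e f assume "e \<in> E" "f \<in> E" "e \<noteq> f"
    then show "V e \<inter> V f = {}"
      using *[of e f] *[of f e] idx by (cases "idx e" "idx f" rule: linorder_cases) (auto simp: inj_on_def)
  qed
qed

text \<open>
  The sequence $E_n$ is built together with open sets $V_n \supseteq E_n$ such that $V_{n+1} \subseteq V_n - E_n$.
  Carrying $V_n$ along is what keeps $E_n$ disjoint from all earlier members and not just from the
  preceding one. Disjoint neighbourhoods of the points of $E_n$ make the union of the discrete
  sets chosen inside them discrete.
\<close>
lemma \<omega>_resolvable_if_all_discrete_limits:
  assumes reg: "regular_space X" and haus: "Hausdorff_space X" and tight: "L_tight X"
    and SX: "S \<subseteq> topspace X" and "S \<noteq> {}" and lim: "S \<subseteq> discrete_limits X S"
  obtains P where "P \<subseteq> S" "P \<noteq> {}" "\<omega>_resolvable_in X P"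
proof -
  have ctbl: "\<exists>D. D \<subseteq> S \<inter> V \<and> countable D \<and> discrete_in X D \<and> p \<notin> D \<and> p \<in> X closure_of D"
    if "p \<in> S" "openin X V" "p \<in> V" for p V
  proof -
    have "p \<in> discrete_limits X (V \<inter> S)"
      using discrete_limits_Int_open[OF that(2)] lim that(1,3) by blast
    then obtain D where D: "D \<subseteq> V \<inter> S" "discrete_in X D" "p \<notin> D" "p \<in> X closure_of D"
      by (auto simp: discrete_limits_def)
    then obtain B where B: "B \<subseteq> D" "Lindelof_space (subtopology X B)" "p \<in> X closure_of B"
      using tight discrete_in_subset_topspace unfolding L_tight_def by meson
    have "discrete_in X B"
      using D(2) B(1) by (rule discrete_in_subset)
    then have "countable B"
      using B(2) discrete_in_subset_topspace by (intro countable_if_discrete_in_Lindelof[of B X B]) auto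
    with \<open>discrete_in X B\<close> B D show ?thesis
      by (intro exI[of _ B]) auto
  qed
  define good where
    "good s \<longleftrightarrow> fst s \<noteq> {} \<and> fst s \<subseteq> S \<inter> snd s \<and> countable (fst s) \<and> discrete_in X (fst s) \<and> openin X (snd s)"
    for s :: "'a set \<times> 'a set"
  define extends where
    "extends s t \<longleftrightarrow> snd t \<subseteq> snd s - fst s \<and> fst s \<subseteq> X closure_of fst t"
    for s t :: "'a set \<times> 'a set"
  have step: "\<exists>t. good t \<and> extends s t" if good: "good s" for s
  proof -
    define E where "E = fst s"
    define V where "V = snd s"
    have E: "E \<subseteq> S \<inter> V" "countable E" "discrete_in X E" "openin X V" "E \<noteq> {}"
      using good by (auto simp: good_def E_def V_def)
    obtain W where W: "\<And>e. e \<in> E \<Longrightarrow> openin X (W e)" "\<And>e. e \<in> E \<Longrightarrow> e \<in> W e"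
      and W_dis: "\<And>e f. e \<in> E \<Longrightarrow> f \<in> E \<Longrightarrow> e \<noteq> f \<Longrightarrow> W e \<inter> W f = {}"
      using countable_discrete_in_disjoint_open_expansion[OF reg E(2,3)] by metis
    have "\<exists>D. D \<subseteq> S \<inter> (W e \<inter> V) \<and> countable D \<and> discrete_in X D \<and> e \<notin> D \<and> e \<in> X closure_of D"
      if "e \<in> E" for e
      using ctbl[of e "W e \<inter> V"] W[OF that] E(1,4) that by blast
    then obtain D where D: "\<And>e. e \<in> E \<Longrightarrow> D e \<subseteq> S \<inter> (W e \<inter> V)" "\<And>e. e \<in> E \<Longrightarrow> countable (D e)"
      "\<And>e. e \<in> E \<Longrightarrow> discrete_in X (D e)" "\<And>e. e \<in> E \<Longrightarrow> e \<notin> D e" "\<And>e. e \<in> E \<Longrightarrow> e \<in> X closure_of D e"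
      by metis
    define E' where "E' = (\<Union>e\<in>E. D e)"
    define V' where "V' = (\<Union>e\<in>E. (W e \<inter> V) - {e})"
    have "closedin X {e}" if "e \<in> E" for e
      using haus SX E(1) that by (intro closedin_Hausdorff_singleton) auto
    then have "openin X V'"
      unfolding V'_def using W(1) E(4) by (intro openin_Union) (auto intro!: openin_diff openin_Int)
    moreover have "E' \<subseteq> S \<inter> V'"
      using D(1,4) unfolding E'_def V'_def by blast
    moreover have "countable E'"
      unfolding E'_def using E(2) D(2) by simp
    moreover have "discrete_in X E'"
      unfolding discrete_in_def
    proof
      fix x assume "x \<in> E'"
      then obtain e where e: "e \<in> E" "x \<in> D e"
        by (auto simp: E'_def)
      then obtain U where U: "openin X U" "U \<inter> D e = {x}"
        using D(3) unfolding discrete_in_def by meson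
      have "(U \<inter> W e) \<inter> E' = {x}"
      proof
        show "(U \<inter> W e) \<inter> E' \<subseteq> {x}"
        proof
          fix y assume y: "y \<in> (U \<inter> W e) \<inter> E'"
          then obtain f where f: "f \<in> E" "y \<in> D f"
            by (auto simp: E'_def)
          then have "y \<in> W f"
            using D(1) by blast
          then have "f = e"
            using W_dis[OF f(1) e(1)] y by auto
          then show "y \<in> {x}"
            using U(2) y f(2) by auto
        qed
        show "{x} \<subseteq> (U \<inter> W e) \<inter> E'"
          using U(2) e D(1)[OF e(1)] by (auto simp: E'_def)
      qed
      then show "\<exists>U. openin X U \<and> U \<inter> E' = {x}"
        using U(1) W(1)[OF e(1)] by (intro exI[of _ "U \<inter> W e"]) auto
    qed
    moreover have "V' \<subseteq> V - E"
    proof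
      fix x assume "x \<in> V'"
      then obtain e where e: "e \<in> E" "x \<in> W e" "x \<in> V" "x \<noteq> e"
        by (auto simp: V'_def)
      then have "x \<notin> E"
        using W(2)[of x] W_dis[of x e] by auto
      then show "x \<in> V - E"
        using e(3) by simp
    qed
    moreover have "E \<subseteq> X closure_of E'"
    proof
      fix e assume e: "e \<in> E"
      then have "X closure_of D e \<subseteq> X closure_of E'"
        unfolding E'_def by (intro closure_of_mono) blast
      then show "e \<in> X closure_of E'"
        using D(5)[OF e] by (rule subsetD)
    qed
    moreover from this have "E' \<noteq> {}"
      using E(5) by auto
    ultimately show ?thesis
      by (intro exI[of _ "(E', V')"]) (simp add: good_def extends_def E_def V_def)
  qed
  obtain p where p: "p \<in> S" using \<open>S \<noteq> {}\<close> by blast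
  have "discrete_in X {p}"
    unfolding discrete_in_def using p SX by (auto intro!: exI[of _ "topspace X"])
  then have "good ({p}, topspace X)"
    using p SX by (auto simp: good_def)
  then have "\<exists>s. \<forall>n. good (s n) \<and> extends (s n) (s (Suc n))"
    using step by (intro dependent_nat_choice) auto
  then obtain s where s: "\<And>n. good (s n)" "\<And>n. extends (s n) (s (Suc n))"
    by blast
  define E where "E n = fst (s n)" for n
  define V where "V n = snd (s n)" for n
  have E: "E n \<subseteq> S" "E n \<subseteq> V n" for n
    using s(1)[of n] by (auto simp: good_def E_def V_def)
  have V_Suc: "V (Suc n) \<subseteq> V n - E n" and E_cl: "E n \<subseteq> X closure_of E (Suc n)" for n
    using s(2)[of n] by (auto simp: extends_def E_def V_def)
  have V_anti: "V n \<subseteq> V m" if "m \<le> n" for m n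
    using that by (rule lift_Suc_antimono_le[rotated]) (use V_Suc in blast)
  show ?thesis
  proof (rule that[of "\<Union>n. E n"])
    show "(\<Union>n. E n) \<subseteq> S"
      using E(1) by blast
    show "\<omega>_resolvable_in X (\<Union>n. E n)"
    proof (rule \<omega>_resolvable_in_UN_sequence)
      show "E n \<subseteq> topspace X" for n
        using E(1) SX by blast
      show "E m \<inter> E n = {}" if "m < n" for m n
        using V_anti[of "Suc m" n] V_Suc[of m] E(2)[of n] that by auto
      show "E n \<subseteq> X closure_of E (Suc n)" for n
        by (rule E_cl)
    qed
    show "(\<Union>n. E n) \<noteq> {}"
      using s(1)[of 0] by (auto simp: good_def E_def)
  qed
qed


section \<open>Iterating the passage to limits of discrete sets\<close>

text \<open>
  If an open set $U$ that meets $Z$ met $T(Z)$ in a countable set only, then $U \cap Z - T(Z)$ would be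
  non-empty, thick and without limits of discrete subsets.
\<close>
lemma discrete_limits_of_thick:
  assumes tight: "L_tight X" and thick: "thick_in X Z"
    and no: "\<And>P. P \<subseteq> Z \<Longrightarrow> P \<noteq> {} \<Longrightarrow> \<not> \<omega>_resolvable_in X P"
  shows "thick_in X (discrete_limits X Z)" and "Z \<subseteq> X closure_of discrete_limits X Z"
proof -
  have ZX: "Z \<subseteq> topspace X"
    using thick by (simp add: thick_in_def)
  have sub: "discrete_limits X Z \<subseteq> Z"
    by (auto simp: discrete_limits_def)
  have unc: "uncountable (U \<inter> discrete_limits X Z)" if U: "openin X U" "U \<inter> Z \<noteq> {}" for U
  proof
    assume ctbl: "countable (U \<inter> discrete_limits X Z)"
    define Y where "Y = U \<inter> Z - discrete_limits X Z"
    have large: "uncountable (V \<inter> Y)" if "openin X V" "V \<inter> U \<inter> Z \<noteq> {}" for V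
    proof
      assume "countable (V \<inter> Y)"
      then have "countable (V \<inter> Y \<union> U \<inter> discrete_limits X Z)"
        using ctbl by simp
      moreover have "(V \<inter> U) \<inter> Z \<subseteq> V \<inter> Y \<union> U \<inter> discrete_limits X Z"
        by (auto simp: Y_def)
      ultimately have "countable ((V \<inter> U) \<inter> Z)"
        using countable_subset by blast
      moreover have "openin X (V \<inter> U)"
        using that(1) U(1) by (rule openin_Int)
      ultimately show False
        using thick that(2) unfolding thick_in_def by blast
    qed
    have "thick_in X Y"
      unfolding thick_in_def
    proof (intro conjI allI impI)
      show "Y \<subseteq> topspace X"
        using ZX by (auto simp: Y_def)
      fix V assume "openin X V \<and> V \<inter> Y \<noteq> {}"
      then show "uncountable (V \<inter> Y)"
        by (intro large) (auto simp: Y_def)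
    qed
    moreover have "Y \<noteq> {}"
      using large[OF U(1)] U(2) by auto
    moreover have "discrete_limits X Y = {}"
      by (auto simp: discrete_limits_def Y_def)
    ultimately obtain P where "P \<subseteq> Y" "P \<noteq> {}" "\<omega>_resolvable_in X P"
      using \<omega>_resolvable_if_thick_without_discrete_limits[OF tight] by metis
    then show False
      using no[of P] by (auto simp: Y_def)
  qed
  show "thick_in X (discrete_limits X Z)"
    unfolding thick_in_def
  proof (intro conjI allI impI)
    show "discrete_limits X Z \<subseteq> topspace X"
      using sub ZX by simp
    fix U assume "openin X U \<and> U \<inter> discrete_limits X Z \<noteq> {}"
    then show "uncountable (U \<inter> discrete_limits X Z)"
      using sub by (intro unc) auto
  qed
  show "Z \<subseteq> X closure_of discrete_limits X Z"
  proof (rule subsetI, rule closure_ofI)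
    fix z U assume "z \<in> Z" "openin X U" "z \<in> U"
    then have "uncountable (U \<inter> discrete_limits X Z)"
      by (intro unc) auto
    then have "U \<inter> discrete_limits X Z \<noteq> {}" by auto
    then show "\<exists>y\<in>discrete_limits X Z. y \<in> U" by blast
  qed (use ZX in blast)
qed

lemma complement_of_discrete_limits_dense:
  assumes "regular_space X" and "Hausdorff_space X" and "L_tight X" and ZX: "Z \<subseteq> topspace X"
    and no: "\<And>P. P \<subseteq> Z \<Longrightarrow> P \<noteq> {} \<Longrightarrow> \<not> \<omega>_resolvable_in X P"
  shows "Z \<subseteq> X closure_of (Z - discrete_limits X Z)"
proof (rule subsetI, rule closure_ofI)
  fix z U assume z: "z \<in> Z" and U: "openin X U" "z \<in> U"
  show "\<exists>y\<in>Z - discrete_limits X Z. y \<in> U"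
  proof (rule ccontr)
    assume "\<not> ?thesis"
    then have "U \<inter> Z \<subseteq> U \<inter> discrete_limits X Z" by blast
    then have "U \<inter> Z \<subseteq> discrete_limits X (U \<inter> Z)"
      using discrete_limits_Int_open[OF U(1)] by (rule subset_trans)
    moreover have "U \<inter> Z \<noteq> {}" "U \<inter> Z \<subseteq> topspace X"
      using z U(2) ZX by auto
    ultimately obtain P where "P \<subseteq> U \<inter> Z" "P \<noteq> {}" "\<omega>_resolvable_in X P"
      using \<omega>_resolvable_if_all_discrete_limits[OF assms(1-3)] by metis
    then show False
      using no[of P] by auto
  qed
qed (use ZX in blast)

text \<open>
  The differences $T^n(Z) - T^{n+1}(Z)$ are disjoint and all dense in $Z$.
\<close>
lemma \<omega>_resolvable_in_thick:
  assumes "regular_space X" and "Hausdorff_space X" and "L_tight X"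
    and thick: "thick_in X Z" and "Z \<noteq> {}"
  obtains P where "P \<subseteq> Z" "P \<noteq> {}" "\<omega>_resolvable_in X P"
proof (rule ccontr)
  assume "\<not> thesis"
  then have no: "\<not> \<omega>_resolvable_in X P" if "P \<subseteq> Z" "P \<noteq> {}" for P
    using \<open>\<And>P. P \<subseteq> Z \<Longrightarrow> P \<noteq> {} \<Longrightarrow> \<omega>_resolvable_in X P \<Longrightarrow> thesis\<close> that by blast
  define T where "T n = (discrete_limits X ^^ n) Z" for n
  have T_Suc: "T (Suc n) = discrete_limits X (T n)" for n
    by (simp add: T_def)
  have T_anti: "T n \<subseteq> T m" if "m \<le> n" for m n
    using that by (rule lift_Suc_antimono_le[rotated]) (auto simp: T_Suc discrete_limits_def)
  have TZ: "T n \<subseteq> Z" for n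
    using T_anti[of 0 n] by (simp add: T_def)
  have no_T: "\<not> \<omega>_resolvable_in X P" if "P \<subseteq> T n" "P \<noteq> {}" for P n
    using no that TZ[of n] by blast
  have T: "thick_in X (T n) \<and> Z \<subseteq> X closure_of T n" for n
  proof (induction n)
    case 0
    then show ?case
      using thick closure_of_subset[of Z X] by (simp add: T_def thick_in_def)
  next
    case (Suc n)
    then have *: "thick_in X (T (Suc n))" "T n \<subseteq> X closure_of T (Suc n)"
      using discrete_limits_of_thick[OF assms(3), of "T n"] no_T[of _ n] by (auto simp: T_Suc)
    then have "X closure_of T n \<subseteq> X closure_of T (Suc n)"
      using closure_of_mono[OF *(2), of X] by simp
    then show ?case
      using Suc *(1) by auto
  qed
  define E where "E n = T n - T (Suc n)" for n
  have ZE: "Z \<subseteq> X closure_of E n" for n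
  proof -
    have "T n \<subseteq> X closure_of E n"
      unfolding E_def T_Suc using T[of n] no_T[of _ n]
      by (intro complement_of_discrete_limits_dense assms) (auto simp: thick_in_def)
    then have "X closure_of T n \<subseteq> X closure_of E n"
      using closure_of_mono[of "T n" "X closure_of E n" X] by simp
    then show ?thesis
      using T[of n] by auto
  qed
  have EZ: "E n \<subseteq> Z" for n
    using TZ[of n] by (auto simp: E_def)
  have "\<omega>_resolvable_in X (\<Union>n. E n)"
  proof (rule \<omega>_resolvable_in_UN_sequence)
    show "E n \<subseteq> topspace X" for n
      using EZ[of n] thick by (auto simp: thick_in_def)
    show "E m \<inter> E n = {}" if "m < n" for m n
      using T_anti[of "Suc m" n] that by (auto simp: E_def)
    show "E n \<subseteq> X closure_of E (Suc n)" for n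
      using EZ[of n] ZE[of "Suc n"] by (rule subset_trans)
  qed
  moreover have "(\<Union>n. E n) \<subseteq> Z"
    using EZ by blast
  moreover have "(\<Union>n. E n) \<noteq> {}"
    using ZE[of 0] \<open>Z \<noteq> {}\<close> by (auto simp: in_closure_of)
  ultimately show False
    using no by blast
qed

theorem theorem9:
  fixes X :: "'a topology"
  assumes "regular_space X" and "Hausdorff_space X"
    and "L_tight X"
    and "natLeq <o dispersion_character X"
  shows "resolvable natLeq X"
proof (rule resolvable_natLeq_if_\<omega>_resolvable_in, rule \<omega>_resolvable_in_topspace_if_locally)
  fix G assume G: "openin X G" "G \<noteq> {}"
  then have "topspace X \<noteq> {}"
    using openin_subset[of X G] by auto
  from dispersion_character_attained[OF this] obtain U where
    U: "dispersion_character X = |U|" "\<And>V. openin X V \<Longrightarrow> V \<noteq> {} \<Longrightarrow> |U| \<le>o |V|"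
    by blast
  have unc: "uncountable V" if "openin X V" "V \<noteq> {}" for V
    using assms(4) U(2)[OF that] unfolding U(1)
    by (metis countable_iff_ordLeq not_ordLess_ordLeq ordLess_ordLeq_trans)
  have "thick_in X G"
    unfolding thick_in_def
    using unc openin_Int[of X _ G] openin_subset[OF G(1)] G(1) by blast
  then show "\<exists>P\<subseteq>G. P \<noteq> {} \<and> \<omega>_resolvable_in X P"
    using \<omega>_resolvable_in_thick[OF assms(1-3)] G(2) by metis
qed

end
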